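(* Let $x=(\mathbf{B}_t)_{t\in J}\in\mathcal{T}$ be an orthogonal TTN-parameter. Let $\mathbf{s}=(s_i)_{i\in D}$, $s_i\in\mathbb{R}^{n_i}$, be an input sample, let $\mathcal{L}:\mathbb{R}^K\to\mathbb{R}$ be a smooth loss function (with the expected response fixed), let $$h:\mathbb{R}^{n_1\times\dots\times n_d\times K}\to\mathbb{R},\qquad h(\mathbf{X})=\mathcal{L}\big((s_1^T\otimes\dots\otimes s_d^T\otimes I_K)\mathbf{X}\big),$$ and let $\bar f=h\circ\phi:\mathcal{E}\to\mathbb{R}$. Then the Euclidean gradient of $\bar f$ at $x$ is $$\nabla\bar f(x)=(\delta\mathbf{B}_t)_{t\in J}=(s_{t_L}\otimes s_{t_R}\otimes l_t)_{t\in J},$$ where the effective samples $s_t\in\mathbb{R}^{k_t}$ ($t\in T$) are defined from the leaves up by $s_{\{i\}}=s_i$ and $s_t^T=(s_{t_L}^T\otimes s_{t_R}^T\otimes I_{k_t})\mathbf{B}_t$ for $t\in J$, and the effective loss gradients $l_t\in\mathbb{R}^{k_t}$ ($t\in J$) are defined from the root down by $l_{t_B}=\nabla\mathcal{L}(s_{t_B})$ and, for $t\in J$, $l_{t_L}=(I\otimes s_{t_R}^T\otimes l_t^T)\mathbf{B}_t$ (if $t_L\in J$) and $l_{t_R}=(s_{t_L}^T\otimes I\otimes l_t^T)\mathbf{B}_t$ (if $t_R\in J$).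
   Context: Dimension tree: for $D=\{1,\dots,d\}$, $T$ is a non-trivial rooted binary tree whose nodes are labeled by subsets of $D$; the root is $t_B=D$; the external nodes (leaves) are $E=\{\{i\}:i\in D\}$; each internal node $t\in J=T\setminus E$ has two children $t_L,t_R$ with $t_L\cup t_R=t$ and $\mu<\nu$ for all $\mu\in t_L,\nu\in t_R$. Put $J^-=J\setminus\{t_B\}$, $L=\{t\in T:|t|=2\}$. Positive integers $(k_t)_{t\in T}$ are fixed, with $n_i:=k_{\{i\}}$ for $i\in D$ and $K:=k_{t_B}$. $(A_1\otimes\dots\otimes A_m)\mathbf{X}$ denotes multilinear multiplication (the matrix $A_j$ is applied to the $j$-th mode of $\mathbf{X}$), where modes contracted with a row vector (resulting dimension 1) are dropped; $u\otimes v\otimes w$ for vectors is the order-3 tensor with entries $u_av_bw_c$. TTN-parameters are elements $x=(\mathbf{B}_t)_{t\in J}$ of the Euclidean space $\mathcal{E}=\prod_{t\in J}\mathbb{R}^{k_{t_L}\times k_{t_R}\times k_t}$ (with the entrywise inner product, with respect to which the gradient is taken). The map $\phi:\mathcal{E}\to\mathbb{R}^{n_1\times\dots\times n_d\times K}$, $x\mapsto\mathbf{X}$, is defined by the recursion: $U_{\{i\}}=I_{n_i}$ for leaves; for $t\in J$, $U_t$ is the matrix with rows indexed by multi-indices $i_t=(i_j)_{j\in t}$, $1\le i_j\le n_j$, i.e. by pairs $(i_{t_L},i_{t_R})$, and columns by $1\le c\le k_t$, with $$U_t[(i_{t_L},i_{t_R}),c]=\sum_{a=1}^{k_{t_L}}\sum_{b=1}^{k_{t_R}}U_{t_L}[i_{t_L},a]\,U_{t_R}[i_{t_R},b]\,(\mathbf{B}_t)_{abc};$$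 finally $\mathbf{X}_{i_1\dots i_d c}=U_{t_B}[(i_1,\dots,i_d),c]$. For an order-3 tensor $\mathbf{B}$, $\mathbf{B}^{(1)}$, $\mathbf{B}^{(2)}$ are the matricizations with rows indexed by the first, respectively second, index; $\mathbf{B}^{(1,2)}$ has rows indexed by the first two indices and columns by the third; $B_t=\mathbf{B}_t^{(1,2)}$. $x$ is full rank if $\mathbf{B}_t^{(1,2)}$ has full column rank $k_t$ for all $t\in J^-$ and $\mathbf{B}_t^{(1)},\mathbf{B}_t^{(2)}$ have full rank for all $t\in J\setminus L$. $\mathcal{T}$ is the set of orthogonal parameters: full-rank $x$ with $B_t^TB_t=I_{k_t}$ for all $t\in J^-$. *)

theory Defs
  imports "HOL-Analysis.Analysis" "HOL-Analysis.Finite_Function_Topology"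
begin

section \<open>Coordinate spaces, gradients, smoothness\<close>

text \<open>
  The dimensions occurring below are values, not types. The space of real arrays indexed by a
  finite set \<open>I\<close> is therefore the subspace of the finitely supported functions whose support
  lies in \<open>I\<close>.
\<close>

abbreviation entry :: "('i \<Rightarrow>\<^sub>0 real) \<Rightarrow> 'i \<Rightarrow> real" where
  "entry \<equiv> Poly_Mapping.lookup"

definition coord_space :: "'i set \<Rightarrow> ('i \<Rightarrow>\<^sub>0 real) set" where
  "coord_space I = {v. Poly_Mapping.keys v \<subseteq> I}"

definition array :: "'i set \<Rightarrow> ('i \<Rightarrow> real) \<Rightarrow> ('i \<Rightarrow>\<^sub>0 real)" where
  "array I f = (\<Sum>i\<in>I. Poly_Mapping.single i (f i))"

lemma entry_array: "finite I \<Longrightarrow> entry (array I f) i = (if i \<in> I then f i else 0)"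
  by (simp add: array_def lookup_sum lookup_single when_def)

lemma array_in_coord_space: "finite I \<Longrightarrow> array I f \<in> coord_space I"
  by (auto simp: coord_space_def in_keys_iff entry_array split: if_splits)

definition entrywise_inner :: "('i \<Rightarrow>\<^sub>0 real) \<Rightarrow> ('i \<Rightarrow>\<^sub>0 real) \<Rightarrow> real" where
  "entrywise_inner v w = (\<Sum>i\<in>Poly_Mapping.keys v. entry v i * entry w i)"

text \<open>
  The gradient with respect to the entrywise inner product of a function on \<open>coord_space I\<close>.
  The library norm on finitely supported functions is the sum of the absolute values of the
  entries; on the finite-dimensional space \<open>coord_space I\<close> it is equivalent to the Euclidean norm,
  so both give the same derivative. Values of \<open>f\<close> outside \<open>coord_space I\<close> are irrelevant.
\<close>

definition has_gradient ::
  "'i set \<Rightarrow> (('i \<Rightarrow>\<^sub>0 real) \<Rightarrow> real) \<Rightarrow> ('i \<Rightarrow>\<^sub>0 real) \<Rightarrow> ('i \<Rightarrow>\<^sub>0 real) \<Rightarrow> bool" where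
  "has_gradient I f x g \<longleftrightarrow>
     g \<in> coord_space I \<and> (f has_derivative entrywise_inner g) (at x within coord_space I)"

definition gradient ::
  "'i set \<Rightarrow> (('i \<Rightarrow>\<^sub>0 real) \<Rightarrow> real) \<Rightarrow> ('i \<Rightarrow>\<^sub>0 real) \<Rightarrow> ('i \<Rightarrow>\<^sub>0 real)" where
  "gradient I f x = (THE g. has_gradient I f x g)"

text \<open>
  \<open>C_times_diff m S f\<close>: \<open>f\<close> is of class \<open>C\<^sup>m\<close> on the finite-dimensional subspace \<open>S\<close>
  (all directional derivatives of the derivative are of class one less).
\<close>

fun C_times_diff :: "nat \<Rightarrow> 'v::real_normed_vector set \<Rightarrow> ('v \<Rightarrow> real) \<Rightarrow> bool" where
  "C_times_diff 0 S f \<longleftrightarrow> continuous_on S f"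
| "C_times_diff (Suc m) S f \<longleftrightarrow>
     (\<exists>f'. (\<forall>x\<in>S. (f has_derivative f' x) (at x within S)) \<and>
           (\<forall>v\<in>S. C_times_diff m S (\<lambda>x. f' x v)))"

definition smooth_on_subspace :: "'v::real_normed_vector set \<Rightarrow> ('v \<Rightarrow> real) \<Rightarrow> bool" where
  "smooth_on_subspace S f \<longleftrightarrow> (\<forall>m. C_times_diff m S f)"

text \<open>Rank of the matrix \<open>M\<close> with row index set \<open>R\<close> and column index set \<open>C\<close>.\<close>

definition mat_rank :: "'r set \<Rightarrow> 'c set \<Rightarrow> ('r \<Rightarrow> 'c \<Rightarrow> real) \<Rightarrow> nat" where
  "mat_rank R C M = dim ((\<lambda>c. array R (\<lambda>r. M r c)) ` C)"

definition full_col_rank :: "'r set \<Rightarrow> 'c set \<Rightarrow> ('r \<Rightarrow> 'c \<Rightarrow> real) \<Rightarrow> bool" where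
  "full_col_rank R C M \<longleftrightarrow> mat_rank R C M = card C"

definition full_rank :: "'r set \<Rightarrow> 'c set \<Rightarrow> ('r \<Rightarrow> 'c \<Rightarrow> real) \<Rightarrow> bool" where
  "full_rank R C M \<longleftrightarrow> mat_rank R C M = min (card R) (card C)"


section \<open>Dimension trees\<close>

text \<open>
  A node of a tree is represented by the subtree below it. In a dimension tree this is equivalent
  to representing it by its label (lemma \<open>inj_on_label\<close>).
\<close>

datatype dtree = is_leaf: Leaf nat | Node (left_child: dtree) (right_child: dtree)

fun label :: "dtree \<Rightarrow> nat set" where
  "label (Leaf i) = {i}"
| "label (Node l r) = label l \<union> label r"

fun tree_nodes :: "dtree \<Rightarrow> dtree set" where
  "tree_nodes (Leaf i) = {Leaf i}"
| "tree_nodes (Node l r) = insert (Node l r) (tree_nodes l \<union> tree_nodes r)"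

definition inner_nodes :: "dtree \<Rightarrow> dtree set" where
  "inner_nodes T = {t \<in> tree_nodes T. \<not> is_leaf t}"

definition ordered_tree :: "dtree \<Rightarrow> bool" where
  "ordered_tree T \<longleftrightarrow>
     (\<forall>t\<in>inner_nodes T. \<forall>\<mu>\<in>label (left_child t). \<forall>\<nu>\<in>label (right_child t). \<mu> < \<nu>)"

definition dimension_tree :: "nat \<Rightarrow> dtree \<Rightarrow> bool" where
  "dimension_tree d T \<longleftrightarrow> \<not> is_leaf T \<and> label T = {1..d} \<and> ordered_tree T"


section \<open>Tree tensor network parameters\<close>

text \<open>
  A parameter is a single array; \<open>entry x (t, a, b, c)\<close> is the entry \<open>(a, b, c)\<close> of the
  order-3 tensor at the inner node \<open>t\<close>. The dimensions are given by \<open>k\<close> on the nodes; in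
  particular \<open>k (Leaf i)\<close> is the size of the \<open>i\<close>-th mode.
\<close>

type_synonym ttn_param = "(dtree \<times> nat \<times> nat \<times> nat) \<Rightarrow>\<^sub>0 real"

definition param_index :: "(dtree \<Rightarrow> nat) \<Rightarrow> dtree \<Rightarrow> (dtree \<times> nat \<times> nat \<times> nat) set" where
  "param_index k T =
     (SIGMA t:inner_nodes T. {1..k (left_child t)} \<times> {1..k (right_child t)} \<times> {1..k t})"

definition ttn_full_rank :: "(dtree \<Rightarrow> nat) \<Rightarrow> dtree \<Rightarrow> ttn_param \<Rightarrow> bool" where
  "ttn_full_rank k T x \<longleftrightarrow>
     (\<forall>t\<in>inner_nodes T - {T}.
        full_col_rank ({1..k (left_child t)} \<times> {1..k (right_child t)}) {1..k t}
          (\<lambda>(a, b) c. entry x (t, a, b, c))) \<and>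
     (\<forall>t\<in>inner_nodes T - {t \<in> tree_nodes T. card (label t) = 2}.
        full_rank {1..k (left_child t)} ({1..k (right_child t)} \<times> {1..k t})
          (\<lambda>a (b, c). entry x (t, a, b, c)) \<and>
        full_rank {1..k (right_child t)} ({1..k (left_child t)} \<times> {1..k t})
          (\<lambda>b (a, c). entry x (t, a, b, c)))"

definition orthogonal_params :: "(dtree \<Rightarrow> nat) \<Rightarrow> dtree \<Rightarrow> ttn_param set" where
  "orthogonal_params k T =
     {x \<in> coord_space (param_index k T). ttn_full_rank k T x \<and>
        (\<forall>t\<in>inner_nodes T - {T}. \<forall>c\<in>{1..k t}. \<forall>c'\<in>{1..k t}.
           (\<Sum>a=1..k (left_child t). \<Sum>b=1..k (right_child t).
              entry x (t, a, b, c) * entry x (t, a, b, c')) = (if c = c' then 1 else 0))}"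

text \<open>
  \<open>U k x t i c\<close> is the entry in row \<open>i\<close> and column \<open>c\<close> of the matrix \<open>U\<^sub>t\<close>. A multi-index is a
  function \<open>i\<close> on the modes, of which \<open>U k x t\<close> only reads the part on \<open>label t\<close>.
\<close>

fun U :: "(dtree \<Rightarrow> nat) \<Rightarrow> ttn_param \<Rightarrow> dtree \<Rightarrow> (nat \<Rightarrow> nat) \<Rightarrow> nat \<Rightarrow> real" where
  "U k x (Leaf j) i c = (if i j = c then 1 else 0)"
| "U k x (Node l r) i c =
     (\<Sum>a=1..k l. \<Sum>b=1..k r. U k x l i a * U k x r i b * entry x (Node l r, a, b, c))"

definition multi_index :: "(dtree \<Rightarrow> nat) \<Rightarrow> dtree \<Rightarrow> (nat \<Rightarrow> nat) set" where
  "multi_index k T = (\<Pi>\<^sub>E j\<in>label T. {1..k (Leaf j)})"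

type_synonym full_tensor = "((nat \<Rightarrow> nat) \<times> nat) \<Rightarrow>\<^sub>0 real"

definition ttn_map :: "(dtree \<Rightarrow> nat) \<Rightarrow> dtree \<Rightarrow> ttn_param \<Rightarrow> full_tensor" where
  "ttn_map k T x = array (multi_index k T \<times> {1..k T}) (\<lambda>(i, c). U k x T i c)"

text \<open>The contraction \<open>(s\<^sub>1\<^sup>T \<otimes> \<dots> \<otimes> s\<^sub>d\<^sup>T \<otimes> I\<^sub>K) X\<close>.\<close>

definition apply_samples ::
  "(dtree \<Rightarrow> nat) \<Rightarrow> dtree \<Rightarrow> (nat \<Rightarrow> nat \<Rightarrow>\<^sub>0 real) \<Rightarrow> full_tensor \<Rightarrow> (nat \<Rightarrow>\<^sub>0 real)" where
  "apply_samples k T s X = array {1..k T}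
     (\<lambda>c. \<Sum>i\<in>multi_index k T. (\<Prod>j\<in>label T. entry (s j) (i j)) * entry X (i, c))"


section \<open>Effective samples and effective loss gradients\<close>

fun eff_sample ::
  "(dtree \<Rightarrow> nat) \<Rightarrow> ttn_param \<Rightarrow> (nat \<Rightarrow> nat \<Rightarrow>\<^sub>0 real) \<Rightarrow> dtree \<Rightarrow> (nat \<Rightarrow>\<^sub>0 real)" where
  "eff_sample k x s (Leaf i) = s i"
| "eff_sample k x s (Node l r) = array {1..k (Node l r)}
     (\<lambda>c. \<Sum>a=1..k l. \<Sum>b=1..k r.
        entry (eff_sample k x s l) a * entry (eff_sample k x s r) b * entry x (Node l r, a, b, c))"

text \<open>
  The vectors that the effective loss gradient \<open>g\<close> of an inner node \<open>t\<close> induces at its children: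
  \<open>(I \<otimes> s\<^sub>R\<^sup>T \<otimes> g\<^sup>T) B\<^sub>t\<close> and \<open>(s\<^sub>L\<^sup>T \<otimes> I \<otimes> g\<^sup>T) B\<^sub>t\<close>, where \<open>s\<^sub>L\<close> and \<open>s\<^sub>R\<close> are the effective samples
  of the children.
\<close>

definition loss_left ::
  "(dtree \<Rightarrow> nat) \<Rightarrow> ttn_param \<Rightarrow> (nat \<Rightarrow> nat \<Rightarrow>\<^sub>0 real) \<Rightarrow> dtree \<Rightarrow> (nat \<Rightarrow>\<^sub>0 real) \<Rightarrow> (nat \<Rightarrow>\<^sub>0 real)" where
  "loss_left k x s t g = array {1..k (left_child t)}
     (\<lambda>a. \<Sum>b=1..k (right_child t). \<Sum>c=1..k t.
        entry (eff_sample k x s (right_child t)) b * entry g c * entry x (t, a, b, c))"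

definition loss_right ::
  "(dtree \<Rightarrow> nat) \<Rightarrow> ttn_param \<Rightarrow> (nat \<Rightarrow> nat \<Rightarrow>\<^sub>0 real) \<Rightarrow> dtree \<Rightarrow> (nat \<Rightarrow>\<^sub>0 real) \<Rightarrow> (nat \<Rightarrow>\<^sub>0 real)" where
  "loss_right k x s t g = array {1..k (right_child t)}
     (\<lambda>b. \<Sum>a=1..k (left_child t). \<Sum>c=1..k t.
        entry (eff_sample k x s (left_child t)) a * entry g c * entry x (t, a, b, c))"

text \<open>
  \<open>loss_down k x s u g t\<close> propagates the vector \<open>g\<close> from the node \<open>u\<close> along the path down to
  its descendant \<open>t\<close>. The lemmas \<open>eff_loss_root\<close>, \<open>eff_loss_left\<close>, \<open>eff_loss_right\<close> below are the
  recursion that defines the effective loss gradients.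
\<close>

fun loss_down ::
  "(dtree \<Rightarrow> nat) \<Rightarrow> ttn_param \<Rightarrow> (nat \<Rightarrow> nat \<Rightarrow>\<^sub>0 real) \<Rightarrow> dtree \<Rightarrow> (nat \<Rightarrow>\<^sub>0 real) \<Rightarrow> dtree \<Rightarrow> (nat \<Rightarrow>\<^sub>0 real)"
where
  "loss_down k x s (Leaf i) g t = g"
| "loss_down k x s (Node l r) g t =
     (if t = Node l r then g
      else if t \<in> tree_nodes l then loss_down k x s l (loss_left k x s (Node l r) g) t
      else loss_down k x s r (loss_right k x s (Node l r) g) t)"

definition eff_loss ::
  "(dtree \<Rightarrow> nat) \<Rightarrow> dtree \<Rightarrow> ttn_param \<Rightarrow> (nat \<Rightarrow> nat \<Rightarrow>\<^sub>0 real) \<Rightarrow> ((nat \<Rightarrow>\<^sub>0 real) \<Rightarrow> real) \<Rightarrow> dtree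
    \<Rightarrow> (nat \<Rightarrow>\<^sub>0 real)" where
  "eff_loss k T x s \<L> t = loss_down k x s T (gradient {1..k T} \<L> (eff_sample k x s T)) t"

lemma label_nonempty: "label t \<noteq> {}"
  by (induction t) auto

lemma label_tree_nodes: "t \<in> tree_nodes T \<Longrightarrow> label t \<subseteq> label T"
  by (induction T) auto

lemma self_in_tree_nodes: "t \<in> tree_nodes t"
  by (cases t) auto

lemma size_tree_nodes: "t \<in> tree_nodes T \<Longrightarrow> size t \<le> size T"
  by (induction T) auto

lemma tree_nodes_trans: "t \<in> tree_nodes u \<Longrightarrow> u \<in> tree_nodes T \<Longrightarrow> t \<in> tree_nodes T"
  by (induction T) auto

lemma ordered_tree_Node:
  assumes "ordered_tree (Node l r)"
  shows "ordered_tree l" "ordered_tree r" "label l \<inter> label r = {}"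
  using assms by (fastforce simp: ordered_tree_def inner_nodes_def)+

lemma not_in_both:
  assumes "label l \<inter> label r = {}" "t \<in> tree_nodes r"
  shows "t \<notin> tree_nodes l"
  using assms label_tree_nodes[of t l] label_tree_nodes[of t r] label_nonempty[of t] by blast

lemma inj_on_label_ordered: "ordered_tree T \<Longrightarrow> inj_on label (tree_nodes T)"
proof (induction T)
  case (Node l r)
  note o = ordered_tree_Node[OF Node.prems]
  have ne: "label l \<noteq> {}" "label r \<noteq> {}" by (rule label_nonempty)+
  have D: "label t \<noteq> label u" if "t \<in> tree_nodes l" "u \<in> tree_nodes r" for t u
    using label_tree_nodes[OF that(1)] label_tree_nodes[OF that(2)] label_nonempty[of t] o(3)
    by blast
  have R: "label t \<noteq> label l \<union> label r" if "t \<in> tree_nodes l \<union> tree_nodes r" for t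
    using that label_tree_nodes[of t l] label_tree_nodes[of t r] ne o(3) by blast
  have I: "inj_on label (tree_nodes l)" "inj_on label (tree_nodes r)"
    using Node.IH o by auto
  have "inj_on label (tree_nodes l \<union> tree_nodes r)"
    unfolding inj_on_Un using I D by blast
  moreover have "label (Node l r) \<notin> label ` (tree_nodes l \<union> tree_nodes r)"
    using R by (metis imageE label.simps(2))
  ultimately show ?case by auto
qed auto

lemma inj_on_label: "dimension_tree d T \<Longrightarrow> inj_on label (tree_nodes T)"
  by (rule inj_on_label_ordered) (simp add: dimension_tree_def)

lemma child_in_tree_nodes:
  assumes "t \<in> inner_nodes T"
  shows "left_child t \<in> tree_nodes T" "right_child t \<in> tree_nodes T"
proof -
  obtain a b where t: "t = Node a b" and T: "t \<in> tree_nodes T"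
    using assms by (cases t) (auto simp: inner_nodes_def)
  have "a \<in> tree_nodes t" "b \<in> tree_nodes t"
    by (simp_all add: t self_in_tree_nodes)
  then have "a \<in> tree_nodes T" "b \<in> tree_nodes T"
    using tree_nodes_trans[OF _ T] by blast+
  then show "left_child t \<in> tree_nodes T" "right_child t \<in> tree_nodes T"
    by (simp_all add: t)
qed

lemma loss_down_self: "loss_down k x s T g T = g"
  by (cases T) auto

lemma loss_down_child:
  assumes "ordered_tree T" "t \<in> inner_nodes T"
  shows "loss_down k x s T g (left_child t) = loss_left k x s t (loss_down k x s T g t) \<and>
         loss_down k x s T g (right_child t) = loss_right k x s t (loss_down k x s T g t)"
  using assms
proof (induction T arbitrary: g)
  case (Leaf i)
  then show ?case by (auto simp: inner_nodes_def)
next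
  case (Node l r)
  note o = ordered_tree_Node[OF Node.prems(1)]
  have small: "u \<noteq> Node l r" if "u \<in> tree_nodes l \<union> tree_nodes r" for u
    using that size_tree_nodes[of u l] size_tree_nodes[of u r] by auto
  consider "t = Node l r" | "t \<in> inner_nodes l" | "t \<in> inner_nodes r"
    using Node.prems(2) by (auto simp: inner_nodes_def)
  then show ?case
  proof cases
    case 1
    have "r \<notin> tree_nodes l" using not_in_both[OF o(3) self_in_tree_nodes] .
    moreover have "l \<noteq> Node l r" "r \<noteq> Node l r"
      using small self_in_tree_nodes by auto
    ultimately show ?thesis unfolding 1 by (simp add: loss_down_self self_in_tree_nodes)
  next
    case 2
    then have "t \<in> tree_nodes l" by (simp add: inner_nodes_def)
    moreover note child_in_tree_nodes[OF 2]
    ultimately show ?thesis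
      using Node.IH(1)[OF o(1) 2] small by simp
  next
    case 3
    then have "t \<in> tree_nodes r" by (simp add: inner_nodes_def)
    moreover note child_in_tree_nodes[OF 3]
    ultimately show ?thesis
      using Node.IH(2)[OF o(2) 3] small not_in_both[OF o(3)] by simp
  qed
qed

lemma eff_loss_root:
  "eff_loss k T x s \<L> T = gradient {1..k T} \<L> (eff_sample k x s T)"
  by (simp add: eff_loss_def loss_down_self)

lemma eff_loss_left:
  assumes "dimension_tree d T" "t \<in> inner_nodes T"
  shows "eff_loss k T x s \<L> (left_child t) = loss_left k x s t (eff_loss k T x s \<L> t)"
  using assms loss_down_child[of T t]
  by (simp add: eff_loss_def dimension_tree_def)

lemma eff_loss_right:
  assumes "dimension_tree d T" "t \<in> inner_nodes T"
  shows "eff_loss k T x s \<L> (right_child t) = loss_right k x s t (eff_loss k T x s \<L> t)"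
  using assms loss_down_child[of T t]
  by (simp add: eff_loss_def dimension_tree_def)

end

theory Submission
  imports Defs
begin

(* The map from a parameter to the effective sample of the root is obtained by contracting X with the
   samples, which can be done node by node because the samples form a pure tensor. So f factors as the loss
   after the effective sample of the root, and the claim is backpropagation: the derivative of the
   effective samples satisfies a product-rule recursion from the leaves up, and pairing it with a
   vector g at the root transposes this recursion into the one that propagates g from the root
   down. *)

section \<open>Gradients on coordinate spaces\<close>

lemma lookup_scaleR: "entry (r *\<^sub>R v) i = r * entry v i"
proof -
  have "finite {i. entry v i \<noteq> 0}" by (rule finite_lookup)
  then have "finite {i. r * entry v i \<noteq> 0}"
    by (rule rev_finite_subset) auto
  then show ?thesis by (simp add: scaleR_poly_mapping_def)
qed

lemma norm_eq_sum_entries: "norm v = (\<Sum>i\<in>Poly_Mapping.keys v. \<bar>entry v i\<bar>)"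
  by (simp add: norm_poly_mapping_def dist_poly_mapping_def)

text \<open>The norm is the sum of the absolute values of all entries, so it dominates each single
  one.\<close>

lemma bounded_linear_entry: "bounded_linear (\<lambda>v. entry v i)"
proof (rule bounded_linear_intro[where K = 1])
  fix v :: "'a \<Rightarrow>\<^sub>0 real"
  show "norm (entry v i) \<le> norm v * 1"
  proof (cases "i \<in> Poly_Mapping.keys v")
    case True
    then show ?thesis
      unfolding norm_eq_sum_entries
      using member_le_sum[OF True, of "\<lambda>i. \<bar>entry v i\<bar>"] by simp
  qed (simp add: in_keys_iff)
qed (simp_all add: lookup_add lookup_scaleR)

lemma bounded_linear_single: "bounded_linear (\<lambda>r. Poly_Mapping.single i (r::real))"
proof (rule bounded_linear_intro[where K = 1])
  fix r q :: real
  show "Poly_Mapping.single i (r + q) = Poly_Mapping.single i r + Poly_Mapping.single i q"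
    by (rule single_add)
  show "Poly_Mapping.single i (r *\<^sub>R q) = r *\<^sub>R Poly_Mapping.single i q"
    by (rule poly_mapping_eqI) (simp add: lookup_scaleR lookup_single when_def)
  show "norm (Poly_Mapping.single i r) \<le> norm r * 1"
    by (simp add: norm_eq_sum_entries)
qed

lemma has_derivative_array:
  assumes "\<And>i. i \<in> I \<Longrightarrow> ((\<lambda>y. f y i) has_derivative (\<lambda>v. f' v i)) F"
  shows "((\<lambda>y. array I (f y)) has_derivative (\<lambda>v. array I (f' v))) F"
  unfolding array_def
  by (intro has_derivative_sum bounded_linear.has_derivative[OF bounded_linear_single] assms)

lemma array_cong: "(\<And>i. i \<in> I \<Longrightarrow> f i = g i) \<Longrightarrow> array I f = array I g"
  by (simp add: array_def)

lemma array_entry: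
  assumes "finite I" "v \<in> coord_space I"
  shows "array I (entry v) = v"
  using assms by (intro poly_mapping_eqI) (auto simp: entry_array coord_space_def in_keys_iff)

lemma entrywise_inner_eq_sum:
  assumes "finite I" "g \<in> coord_space I"
  shows "entrywise_inner g v = (\<Sum>i\<in>I. entry g i * entry v i)"
  unfolding entrywise_inner_def using assms
  by (intro sum.mono_neutral_left) (auto simp: coord_space_def in_keys_iff)

lemma bounded_linear_entrywise_inner: "bounded_linear (entrywise_inner g)"
proof -
  have "bounded_linear (\<lambda>v. \<Sum>i\<in>Poly_Mapping.keys g. entry g i * entry v i)"
    by (intro bounded_linear_sum bounded_linear_const_mult bounded_linear_entry)
  then show ?thesis by (simp add: entrywise_inner_def[abs_def])
qed

section \<open>Existence and uniqueness of the gradient within a coordinate space\<close>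

lemma coord_space_diff:
  "v \<in> coord_space I \<Longrightarrow> w \<in> coord_space I \<Longrightarrow> v - w \<in> coord_space I"
  using keys_diff[of v w] by (auto simp: coord_space_def)

lemma coord_space_add_single:
  "v \<in> coord_space I \<Longrightarrow> i \<in> I \<Longrightarrow> v + Poly_Mapping.single i r \<in> coord_space I"
  by (auto simp: coord_space_def in_keys_iff lookup_add lookup_single when_def split: if_splits)

text \<open>Riesz representation in coordinates: the entries of the gradient are the values of
  \<open>f'\<close> on the unit arrays. The two linear maps need to agree only on
  \<open>coord_space I\<close>.\<close>

lemma has_gradient_of_derivative:
  assumes "finite I" "x \<in> coord_space I"
    and f': "(f has_derivative f') (at x within coord_space I)"
  shows "has_gradient I f x (array I (\<lambda>i. f' (Poly_Mapping.single i 1)))" (is "has_gradient _ _ _ ?g")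
proof -
  interpret bounded_linear f' using f' by (rule has_derivative_bounded_linear)
  have eq: "entrywise_inner ?g v = f' v" if "v \<in> coord_space I" for v
  proof -
    have "f' v = f' (\<Sum>i\<in>I. entry v i *\<^sub>R Poly_Mapping.single i 1)"
      using array_entry[OF assms(1) that]
      by (simp add: array_def
          linear_scale[OF bounded_linear.linear[OF bounded_linear_single], of _ _ 1, simplified, symmetric])
    also have "\<dots> = (\<Sum>i\<in>I. entry v i * f' (Poly_Mapping.single i 1))"
      by (simp add: sum scaleR)
    finally show ?thesis
      using assms(1) by (simp add: entrywise_inner_eq_sum[OF _ array_in_coord_space] entry_array mult.commute)
  qed
  have "(f has_derivative entrywise_inner ?g) (at x within coord_space I)"
    unfolding has_derivative_within
  proof (intro conjI bounded_linear_entrywise_inner)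
    show "((\<lambda>y. (1 / norm (y - x)) *\<^sub>R (f y - (f x + entrywise_inner ?g (y - x)))) \<longlongrightarrow> 0)
       (at x within coord_space I)"
    proof (rule Lim_transform_within[OF _ zero_less_one])
      show "((\<lambda>y. (1 / norm (y - x)) *\<^sub>R (f y - (f x + f' (y - x)))) \<longlongrightarrow> 0)
         (at x within coord_space I)"
        using f' by (simp add: has_derivative_within)
    \<comment> \<open>The limit within the subspace only evaluates the linear maps at differences
      \<open>y - x\<close> of its points, where \<open>eq\<close> applies.\<close>
    qed (simp add: eq coord_space_diff assms(2))
  qed
  then show ?thesis
    by (simp add: has_gradient_def array_in_coord_space assms(1))
qed

text \<open>A derivative within a proper subspace does not determine a linear map on the ambient
  space. Restricting to the coordinate lines through \<open>x\<close> gives functions of one real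
  variable with a unique derivative at 0, which fixes every entry in \<open>I\<close>; the other
  entries vanish by membership in \<open>coord_space I\<close>.\<close>

lemma has_gradient_unique:
  assumes "finite I" "x \<in> coord_space I" "has_gradient I f x g" "has_gradient I f x h"
  shows "g = h"
proof (rule poly_mapping_eqI)
  fix i
  have D: "((\<lambda>r. f (x + Poly_Mapping.single i r)) has_derivative (\<lambda>r. r * entry g i)) (at 0)"
    if g: "has_gradient I f x g" and i: "i \<in> I" for g
  proof -
    have "((\<lambda>r. x + Poly_Mapping.single i r) has_derivative Poly_Mapping.single i) (at 0)"
      using has_derivative_add[OF has_derivative_const
          bounded_linear.has_derivative[OF bounded_linear_single has_derivative_ident]] by simp
    moreover have "(f has_derivative entrywise_inner g)
        (at (x + Poly_Mapping.single i 0) within range (\<lambda>r. x + Poly_Mapping.single i r))"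
      using g coord_space_add_single[OF assms(2) i]
      by (auto simp: has_gradient_def intro: has_derivative_subset)
    ultimately have "((\<lambda>r. f (x + Poly_Mapping.single i r)) has_derivative
        (\<lambda>r. entrywise_inner g (Poly_Mapping.single i r))) (at 0)"
      by (rule has_derivative_in_compose)
    moreover have "entrywise_inner g (Poly_Mapping.single i r) = r * entry g i" for r
    proof -
      have "entrywise_inner g (Poly_Mapping.single i r) =
          (\<Sum>j\<in>I. entry g j * (if i = j then r else 0))"
        using g assms(1) by (simp add: has_gradient_def entrywise_inner_eq_sum lookup_single when_def)
      also have "\<dots> = (\<Sum>j\<in>I. if i = j then r * entry g j else 0)"
        by (rule sum.cong) auto
      also have "\<dots> = r * entry g i" using assms(1) i by simp
      finally show ?thesis .
    qed
    ultimately show ?thesis by simp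
  qed
  show "entry g i = entry h i"
  proof (cases "i \<in> I")
    case True
    have "(\<lambda>r. r * entry g i) = (\<lambda>r. r * entry h i)"
      by (rule has_derivative_unique[OF D[OF assms(3) True] D[OF assms(4) True]])
    from fun_cong[OF this, of 1] show ?thesis by simp
  next
    case False
    then show ?thesis
      using assms(3,4) in_keys_iff[of i g] in_keys_iff[of i h]
      by (auto simp: has_gradient_def coord_space_def)
  qed
qed

text \<open>Existence and uniqueness together justify the definite description in
  \<open>gradient\<close> wherever a derivative exists.\<close>

lemma has_gradient_gradient:
  assumes "finite I" "x \<in> coord_space I" "(f has_derivative f') (at x within coord_space I)"
  shows "has_gradient I f x (gradient I f x)"
  unfolding gradient_def
  by (rule theI[where a = "array I (\<lambda>i. f' (Poly_Mapping.single i 1))"])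
    (blast intro: has_gradient_of_derivative[OF assms] has_gradient_unique[OF assms(1,2)])+

lemma smooth_on_subspace_imp_derivative:
  assumes "smooth_on_subspace S f" "x \<in> S"
  shows "\<exists>f'. (f has_derivative f') (at x within S)"
proof -
  have "C_times_diff (Suc 0) S f" using assms(1) by (simp add: smooth_on_subspace_def)
  then show ?thesis using assms(2) by auto
qed


section \<open>Contraction of the represented tensor with the samples\<close>

lemma finite_label: "finite (label t)"
  by (induction t) auto

lemma finite_multi_index: "finite (multi_index k t)"
  by (simp add: multi_index_def finite_PiE finite_label)

lemma U_cong: "(\<And>j. j \<in> label t \<Longrightarrow> i j = i' j) \<Longrightarrow> U k x t i c = U k x t i' c"
  by (induction t arbitrary: c) auto

text \<open>\<open>f\<close> depends only on the coordinates in \<open>A\<close> and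
  \<open>g\<close> only on those in \<open>B\<close>. Restriction to \<open>A\<close> and
  \<open>B\<close>, with inverse \<open>merge\<close>, turns the index set into a product, over
  which the sum factorises.\<close>

lemma sum_PiE_Un:
  fixes f g :: "('a \<Rightarrow> 'b) \<Rightarrow> 'c::semiring_0"
  assumes "A \<inter> B = {}"
    and f: "\<And>i i'. (\<And>j. j \<in> A \<Longrightarrow> i j = i' j) \<Longrightarrow> f i = f i'"
    and g: "\<And>i i'. (\<And>j. j \<in> B \<Longrightarrow> i j = i' j) \<Longrightarrow> g i = g i'"
  shows "(\<Sum>i\<in>Pi\<^sub>E (A \<union> B) S. f i * g i) = (\<Sum>i\<in>Pi\<^sub>E A S. f i) * (\<Sum>i\<in>Pi\<^sub>E B S. g i)"
proof -
  have "(\<Sum>i\<in>Pi\<^sub>E (A \<union> B) S. f i * g i) = (\<Sum>(p, q)\<in>Pi\<^sub>E A S \<times> Pi\<^sub>E B S. f p * g q)"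
  proof (rule sum.reindex_bij_witness[where i = "merge A B"
        and j = "\<lambda>i. (restrict i A, restrict i B)"])
    fix i assume i: "i \<in> Pi\<^sub>E (A \<union> B) S"
    then show "merge A B (restrict i A, restrict i B) = i"
      by (simp add: PiE_restrict)
    show "(restrict i A, restrict i B) \<in> Pi\<^sub>E A S \<times> Pi\<^sub>E B S"
      using i by auto
    show "(case (restrict i A, restrict i B) of (p, q) \<Rightarrow> f p * g q) = f i * g i"
      using f[of "restrict i A" i] g[of "restrict i B" i] by simp
  next
    fix pq assume "pq \<in> Pi\<^sub>E A S \<times> Pi\<^sub>E B S"
    then obtain p q where "pq = (p, q)" "p \<in> Pi\<^sub>E A S" "q \<in> Pi\<^sub>E B S" by blast
    then show "(restrict (merge A B pq) A, restrict (merge A B pq) B) = pq"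
      "merge A B pq \<in> Pi\<^sub>E (A \<union> B) S"
      using assms(1) by (auto simp: PiE_restrict)
  qed
  then show ?thesis
    by (simp add: sum_product sum.cartesian_product)
qed

text \<open>The weight is a product over the leaves, so at a node it splits into the weights of the
  two children, and each partial sum is an effective sample by induction. The bound on
  \<open>c\<close> matters because neither \<open>s\<close> nor \<open>y\<close> is assumed to be
  supported in the index ranges.\<close>

lemma sum_multi_index_U:
  assumes "ordered_tree t" "c \<in> {1..k t}"
  shows "(\<Sum>i\<in>multi_index k t. (\<Prod>j\<in>label t. entry (s j) (i j)) * U k y t i c) =
    entry (eff_sample k y s t) c"
  using assms
proof (induction t arbitrary: c)
  case (Leaf m)
  \<comment> \<open>A multi-index with the single mode \<open>m\<close> is determined by its value
    there.\<close>
  have "(\<Sum>i\<in>multi_index k (Leaf m). (\<Prod>j\<in>label (Leaf m). entry (s j) (i j)) * U k y (Leaf m) i c)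
      = (\<Sum>a\<in>{1..k (Leaf m)}. if a = c then entry (s m) a else 0)"
    by (rule sum.reindex_bij_witness[where j = "\<lambda>i. i m" and i = "\<lambda>a. \<lambda>j\<in>{m}. a"])
      (auto simp: multi_index_def PiE_iff extensional_def)
  also have "\<dots> = entry (s m) c" using Leaf by simp
  finally show ?case by simp
next
  case (Node l r)
  note o = ordered_tree_Node[OF Node.prems(1)]
  \<comment> \<open>The weighted entry for a subtree as a function of the whole multi-index, so that
    both children can be evaluated at the same \<open>i\<close>.\<close>
  define F where "F t a i = (\<Prod>j\<in>label t. entry (s j) (i j)) * U k y t i a" for t a i
  have F_cong: "F t a i = F t a i'" if "\<And>j. j \<in> label t \<Longrightarrow> i j = i' j" for t a i i'
    using that U_cong[of t i i' k y a] by (simp add: F_def)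
  have F_Node: "F (Node l r) c i =
      (\<Sum>a=1..k l. \<Sum>b=1..k r. F l a i * F r b i * entry y (Node l r, a, b, c))" for i
    by (simp add: F_def prod.union_disjoint[OF finite_label finite_label o(3)] sum_distrib_left mult_ac)
  have "(\<Sum>i\<in>multi_index k (Node l r). F (Node l r) c i) =
      (\<Sum>a=1..k l. \<Sum>b=1..k r. (\<Sum>i\<in>multi_index k (Node l r). F l a i * F r b i) *
        entry y (Node l r, a, b, c))"
    by (simp only: F_Node sum_distrib_right sum.swap[of _ "multi_index k (Node l r)"])
  also have "\<dots> = (\<Sum>a=1..k l. \<Sum>b=1..k r. (\<Sum>i\<in>multi_index k l. F l a i) *
        (\<Sum>i\<in>multi_index k r. F r b i) * entry y (Node l r, a, b, c))"
    by (simp add: multi_index_def sum_PiE_Un[OF o(3) F_cong F_cong])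
  also have "\<dots> = (\<Sum>a=1..k l. \<Sum>b=1..k r. entry (eff_sample k y s l) a *
        entry (eff_sample k y s r) b * entry y (Node l r, a, b, c))"
    unfolding F_def using Node.IH(1)[OF o(1)] Node.IH(2)[OF o(2)]
    by (intro sum.cong refl) simp
  finally show ?case
    using Node.prems(2) by (simp add: F_def entry_array)
qed

text \<open>This factors the objective through the effective sample of the root, for every parameter
  array \<open>y\<close>. At an inner node the effective sample is an array on
  \<open>{1..k t}\<close>, so comparing the entries in that range suffices.\<close>

lemma apply_samples_ttn_map:
  assumes "ordered_tree t" "\<not> is_leaf t"
  shows "apply_samples k t s (ttn_map k t y) = eff_sample k y s t"
proof -
  have "eff_sample k y s t \<in> coord_space {1..k t}"
    using assms(2) by (cases t) (simp_all add: array_in_coord_space)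
  then have "eff_sample k y s t = array {1..k t} (entry (eff_sample k y s t))"
    by (simp add: array_entry)
  also have "\<dots> = apply_samples k t s (ttn_map k t y)"
    unfolding apply_samples_def ttn_map_def using finite_multi_index[of k t]
    by (intro array_cong)
      (simp add: sum_multi_index_U[OF assms(1), symmetric] entry_array)
  finally show ?thesis ..
qed


section \<open>Forward pass: the derivative of the effective samples\<close>

section \<open>Backpropagation\<close>

text \<open>The directional derivative of the effective sample at \<open>x\<close> along
  \<open>v\<close>: the three summands are the product rule, and samples at leaves are constant.
  Values are not cut off outside the range of \<open>c\<close>, unlike the entries of
  \<open>eff_sample\<close> at inner nodes.\<close>

fun eff_deriv :: "(dtree \<Rightarrow> nat) \<Rightarrow> ttn_param \<Rightarrow> (nat \<Rightarrow> nat \<Rightarrow>\<^sub>0 real) \<Rightarrow> ttn_param \<Rightarrow> dtree \<Rightarrow> nat \<Rightarrow> real"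
where
  "eff_deriv k x s v (Leaf i) c = 0"
| "eff_deriv k x s v (Node l r) c =
     (\<Sum>a=1..k l. \<Sum>b=1..k r.
        eff_deriv k x s v l a * entry (eff_sample k x s r) b * entry x (Node l r, a, b, c) +
        entry (eff_sample k x s l) a * eff_deriv k x s v r b * entry x (Node l r, a, b, c) +
        entry (eff_sample k x s l) a * entry (eff_sample k x s r) b * entry v (Node l r, a, b, c))"

lemma has_derivative_eff_sample:
  assumes "c \<in> {1..k t}"
  shows "((\<lambda>y. entry (eff_sample k y s t) c) has_derivative (\<lambda>v. eff_deriv k x s v t c))
    (at x within S)"
  using assms
proof (induction t arbitrary: c)
  case (Leaf i)
  then show ?case by simp
next
  case (Node l r)
  have "((\<lambda>y. \<Sum>a=1..k l. \<Sum>b=1..k r. entry (eff_sample k y s l) a *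
        entry (eff_sample k y s r) b * entry y (Node l r, a, b, c)) has_derivative
      (\<lambda>v. eff_deriv k x s v (Node l r) c)) (at x within S)"
    unfolding eff_deriv.simps
  proof (intro has_derivative_sum)
    fix a b assume ab: "a \<in> {1..k l}" "b \<in> {1..k r}"
    note E = bounded_linear.has_derivative[OF bounded_linear_entry has_derivative_ident,
        of "(Node l r, a, b, c)" "at x within S"]
    show "((\<lambda>y. entry (eff_sample k y s l) a * entry (eff_sample k y s r) b *
          entry y (Node l r, a, b, c)) has_derivative
        (\<lambda>v. eff_deriv k x s v l a * entry (eff_sample k x s r) b * entry x (Node l r, a, b, c) +
          entry (eff_sample k x s l) a * eff_deriv k x s v r b * entry x (Node l r, a, b, c) +
          entry (eff_sample k x s l) a * entry (eff_sample k x s r) b * entry v (Node l r, a, b, c)))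
        (at x within S)"
      by (rule has_derivative_eq_rhs
          [OF has_derivative_mult[OF has_derivative_mult[OF Node.IH(1)[OF ab(1)] Node.IH(2)[OF ab(2)]] E]])
        (simp add: fun_eq_iff algebra_simps)
  qed
  then show ?case using Node.prems by (simp add: entry_array)
qed

section \<open>Backward pass: the adjoint of this derivative\<close>

lemma finite_inner_nodes: "finite (inner_nodes t)"
proof -
  have "finite (tree_nodes t)" by (induction t) auto
  then show ?thesis by (simp add: inner_nodes_def)
qed

text \<open>Nodes are subtrees, so equal subtrees on both sides would be counted once. Disjoint
  labels exclude this, and size excludes the tree itself from its children.\<close>

lemma sum_inner_nodes_Node:
  assumes "ordered_tree (Node l r)"
  shows "sum f (inner_nodes (Node l r)) = f (Node l r) + sum f (inner_nodes l) + sum f (inner_nodes r)"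
proof -
  have "inner_nodes (Node l r) = insert (Node l r) (inner_nodes l \<union> inner_nodes r)"
    by (auto simp: inner_nodes_def)
  moreover have "Node l r \<notin> inner_nodes l \<union> inner_nodes r"
    using size_tree_nodes[of "Node l r" l] size_tree_nodes[of "Node l r" r]
    by (auto simp: inner_nodes_def)
  moreover have "inner_nodes l \<inter> inner_nodes r = {}"
    using not_in_both[OF ordered_tree_Node(3)[OF assms]] by (auto simp: inner_nodes_def)
  ultimately show ?thesis
    by (simp add: finite_inner_nodes sum.union_disjoint add.assoc)
qed

text \<open>\<open>loss_down\<close> tests the left subtree first; disjointness of the labels makes
  the right branch reachable for every node of \<open>r\<close>.\<close>

lemma loss_down_Node:
  assumes "ordered_tree (Node l r)"
  shows "u \<in> tree_nodes l \<Longrightarrow>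
      loss_down k x s (Node l r) g u = loss_down k x s l (loss_left k x s (Node l r) g) u"
    and "u \<in> tree_nodes r \<Longrightarrow>
      loss_down k x s (Node l r) g u = loss_down k x s r (loss_right k x s (Node l r) g) u"
  using size_tree_nodes[of u l] size_tree_nodes[of u r]
    not_in_both[OF ordered_tree_Node(3)[OF assms], of u] by auto

text \<open>Pairing the product rule with \<open>g\<close> gives three terms: the derivative at the
  left child paired with \<open>loss_left\<close>, the one at the right child paired with
  \<open>loss_right\<close>, and the contribution of the node itself. As the paired vector changes
  on the way down, the induction generalises over \<open>g\<close>.\<close>

lemma sum_eff_deriv:
  assumes "ordered_tree t"
  shows "(\<Sum>c=1..k t. entry g c * eff_deriv k x s v t c) =
    (\<Sum>u\<in>inner_nodes t. \<Sum>a=1..k (left_child u). \<Sum>b=1..k (right_child u). \<Sum>c=1..k u.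
       entry (eff_sample k x s (left_child u)) a * entry (eff_sample k x s (right_child u)) b *
       entry (loss_down k x s t g u) c * entry v (u, a, b, c))"
  using assms
proof (induction t arbitrary: g)
  case (Leaf i)
  have "inner_nodes (Leaf i) = {}" by (auto simp: inner_nodes_def)
  then show ?case by simp
next
  case (Node l r)
  note o = ordered_tree_Node[OF Node.prems]
  let ?t = "Node l r"
  define G where "G g' t u = (\<Sum>a=1..k (left_child u). \<Sum>b=1..k (right_child u). \<Sum>c=1..k u.
       entry (eff_sample k x s (left_child u)) a * entry (eff_sample k x s (right_child u)) b *
       entry (loss_down k x s t g' u) c * entry v (u, a, b, c))" for g' t u
  let ?sl = "entry (eff_sample k x s l)" and ?sr = "entry (eff_sample k x s r)"
  let ?B = "\<lambda>a b c. entry x (?t, a, b, c)"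
  have swap: "(\<Sum>c=1..k ?t. \<Sum>a=1..k l. \<Sum>b=1..k r. f a b c) =
      (\<Sum>a=1..k l. \<Sum>b=1..k r. \<Sum>c=1..k ?t. f a b c)" for f :: "nat \<Rightarrow> nat \<Rightarrow> nat \<Rightarrow> real"
    by (subst sum.swap) (intro sum.cong refl sum.swap)
  \<comment> \<open>\<open>loss_right\<close> fixes \<open>b\<close> and sums over \<open>a\<close>
    and \<open>c\<close>, so its term needs \<open>b\<close> as the outermost index.\<close>
  have swap': "(\<Sum>a=1..k l. \<Sum>b=1..k r. \<Sum>c=1..k ?t. f a b c) =
      (\<Sum>b=1..k r. \<Sum>a=1..k l. \<Sum>c=1..k ?t. f a b c)" for f :: "nat \<Rightarrow> nat \<Rightarrow> nat \<Rightarrow> real"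
    by (rule sum.swap)
  have "(\<Sum>c=1..k ?t. entry g c * eff_deriv k x s v ?t c) =
      (\<Sum>a=1..k l. \<Sum>b=1..k r. \<Sum>c=1..k ?t. eff_deriv k x s v l a * (?sr b * entry g c * ?B a b c)) +
      (\<Sum>a=1..k l. \<Sum>b=1..k r. \<Sum>c=1..k ?t. eff_deriv k x s v r b * (?sl a * entry g c * ?B a b c)) +
      (\<Sum>a=1..k l. \<Sum>b=1..k r. \<Sum>c=1..k ?t. ?sl a * ?sr b * entry g c * entry v (?t, a, b, c))"
    unfolding swap[symmetric] eff_deriv.simps
    by (simp add: sum_distrib_left sum.distrib algebra_simps)
  also have "\<dots> = (\<Sum>a=1..k l. entry (loss_left k x s ?t g) a * eff_deriv k x s v l a) +
      (\<Sum>b=1..k r. entry (loss_right k x s ?t g) b * eff_deriv k x s v r b) + G g ?t ?t"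
    by (subst (2) swap')
      (simp add: loss_left_def loss_right_def entry_array sum_distrib_left sum_distrib_right G_def mult_ac)
  also have "\<dots> = sum (G (loss_left k x s ?t g) l) (inner_nodes l) +
      sum (G (loss_right k x s ?t g) r) (inner_nodes r) + G g ?t ?t"
    using Node.IH(1)[OF o(1)] Node.IH(2)[OF o(2)] by (simp add: G_def)
  \<comment> \<open>Propagation started at a child with its induced vector agrees with propagation
    of \<open>g\<close> from \<open>?t\<close>.\<close>
  also have "sum (G (loss_left k x s ?t g) l) (inner_nodes l) = sum (G g ?t) (inner_nodes l)"
    unfolding G_def
    by (intro sum.cong refl) (simp add: inner_nodes_def loss_down_Node(1)[OF Node.prems] del: loss_down.simps)
  also have "sum (G (loss_right k x s ?t g) r) (inner_nodes r) = sum (G g ?t) (inner_nodes r)"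
    unfolding G_def
    by (intro sum.cong refl) (simp add: inner_nodes_def loss_down_Node(2)[OF Node.prems] del: loss_down.simps)
  finally show ?case
    unfolding G_def[symmetric] sum_inner_nodes_Node[OF Node.prems] by (simp only: add_ac)
qed

section \<open>The gradient by the chain rule\<close>

theorem theorem6p1:
  fixes d :: nat and T :: dtree and k :: "dtree \<Rightarrow> nat" and x :: ttn_param
    and s :: "nat \<Rightarrow> nat \<Rightarrow>\<^sub>0 real" and \<L> :: "(nat \<Rightarrow>\<^sub>0 real) \<Rightarrow> real"
  assumes "dimension_tree d T"
    and "\<And>t. t \<in> tree_nodes T \<Longrightarrow> 0 < k t"
    and "x \<in> orthogonal_params k T"
    and "\<And>i. i \<in> {1..d} \<Longrightarrow> s i \<in> coord_space {1..k (Leaf i)}"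
    and "smooth_on_subspace (coord_space {1..k T}) \<L>"
  shows "has_gradient (param_index k T)
           ((\<lambda>X. \<L> (apply_samples k T s X)) \<circ> ttn_map k T) x
           (array (param_index k T)
              (\<lambda>(t, a, b, c). entry (eff_sample k x s (left_child t)) a *
                 entry (eff_sample k x s (right_child t)) b *
                 entry (eff_loss k T x s \<L> t) c))"
proof -
  let ?K = "{1..k T}" and ?P = "param_index k T"
  let ?z = "eff_sample k x s T"
  let ?g = "gradient ?K \<L> ?z"
  let ?G = "array ?P (\<lambda>(t, a, b, c). entry (eff_sample k x s (left_child t)) a *
    entry (eff_sample k x s (right_child t)) b * entry (eff_loss k T x s \<L> t) c)"
  have T: "ordered_tree T" "\<not> is_leaf T"
    using assms(1) by (simp_all add: dimension_tree_def)
  have fin: "finite ?P"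
    by (simp add: param_index_def finite_inner_nodes)
  have eff_array: "eff_sample k y s T = array ?K (entry (eff_sample k y s T))" for y
    using T(2) by (cases T) (simp_all add: array_entry array_in_coord_space)
  have eff_in: "eff_sample k y s T \<in> coord_space ?K" for y
    by (subst eff_array) (simp add: array_in_coord_space)
  have g: "has_gradient ?K \<L> ?z ?g"
    using smooth_on_subspace_imp_derivative[OF assms(5) eff_in[of x]]
      has_gradient_gradient[OF _ eff_in[of x]] by blast
  have D: "((\<lambda>y. eff_sample k y s T) has_derivative (\<lambda>v. array ?K (eff_deriv k x s v T)))
      (at x within coord_space ?P)"
    by (subst eff_array) (intro has_derivative_array has_derivative_eff_sample)
  \<comment> \<open>\<open>\<L>\<close> is differentiable only within \<open>coord_space ?K\<close>;
    this suffices because all effective samples of the root lie there.\<close>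
  have "(\<L> has_derivative entrywise_inner ?g)
      (at ?z within (\<lambda>y. eff_sample k y s T) ` coord_space ?P)"
    using g eff_in by (auto simp: has_gradient_def intro: has_derivative_subset)
  from has_derivative_in_compose[OF D this]
  have "((\<lambda>y. \<L> (eff_sample k y s T)) has_derivative
      (\<lambda>v. entrywise_inner ?g (array ?K (eff_deriv k x s v T)))) (at x within coord_space ?P)" .
  \<comment> \<open>The identity holds for every \<open>v\<close>, even outside
    \<open>coord_space ?P\<close>, since both sides read only entries of \<open>v\<close> indexed by
    \<open>?P\<close>. Hence the derivative can be replaced as a function.\<close>
  moreover have "entrywise_inner ?g (array ?K (eff_deriv k x s v T)) = entrywise_inner ?G v" for v
  proof -
    have "entrywise_inner ?g (array ?K (eff_deriv k x s v T)) =
        (\<Sum>c\<in>?K. entry ?g c * eff_deriv k x s v T c)"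
      using g by (simp add: has_gradient_def entrywise_inner_eq_sum[of ?K] entry_array)
    also have "\<dots> = (\<Sum>u\<in>inner_nodes T. \<Sum>a=1..k (left_child u). \<Sum>b=1..k (right_child u). \<Sum>c=1..k u.
       entry (eff_sample k x s (left_child u)) a * entry (eff_sample k x s (right_child u)) b *
       entry (eff_loss k T x s \<L> u) c * entry v (u, a, b, c))"
      unfolding eff_loss_def by (rule sum_eff_deriv[OF T(1)])
    also have "\<dots> = (\<Sum>p\<in>?P. entry ?G p * entry v p)"
    proof -
      have "(\<Sum>p\<in>?P. entry ?G p * entry v p) =
          (\<Sum>(u, a, b, c)\<in>?P. entry (eff_sample k x s (left_child u)) a *
             entry (eff_sample k x s (right_child u)) b * entry (eff_loss k T x s \<L> u) c *
             entry v (u, a, b, c))"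
        using fin by (intro sum.cong refl) (simp add: entry_array split: prod.split)
      then show ?thesis
        by (simp add: param_index_def sum.cartesian_product sum.Sigma finite_inner_nodes)
    qed
    also have "\<dots> = entrywise_inner ?G v"
      by (simp add: entrywise_inner_eq_sum[OF fin array_in_coord_space[OF fin]])
    finally show ?thesis .
  qed
  ultimately show ?thesis
    by (simp add: has_gradient_def array_in_coord_space[OF fin] comp_def apply_samples_ttn_map[OF T])
qed

end
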